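(* The worst case minimizer $\widehat{x}_\infty$ is measurable and essentially bounded on $(0,T)$, and hence $\widehat{x}_\infty\in L^\infty(0,T;\mathbb{R}^n)$.
   Context: Setting. Fix $T>0$, $n,m,r\in\mathbb{N}$, $B\in\mathbb{R}^{n\times m}$, $C\in\mathbb{R}^{r\times n}$, $x_0\in\mathbb{R}^n$ and a measured output $y\in L^2(0,T;\mathbb{R}^r)$. $\|\cdot\|$ is the Euclidean norm, and $\|x\|_M^2=x^\top M x$ for a symmetric positive definite matrix $M$. Let $\Sigma=\Sigma_A\times\Sigma_\Gamma\times\Sigma_R\times\Sigma_Q$ be a product of finite nonempty sets, $\Sigma=\{\sigma_1,\dots,\sigma_N\}$, $N=|\Sigma|$. To each $\sigma=(\sigma_A,\sigma_\Gamma,\sigma_R,\sigma_Q)$ are assigned matrices $A_\sigma\in\mathbb{R}^{n\times n}$ (depending on $\sigma_A$ only) and symmetric positive definite matrices $\Gamma_\sigma\in\mathbb{R}^{n\times n}$, $R_\sigma\in\mathbb{R}^{m\times m}$, $Q_\sigma\in\mathbb{R}^{r\times r}$ (depending only on $\sigma_\Gamma$, $\sigma_R$, $\sigma_Q$ respectively). Index $k$ means $\sigma=\sigma_k$. For each $k$, $\Pi_k$ is the unique solution on $[0,T]$ of $\dot\Pi_k = A_k\Pi_k+\Pi_kA_k^\top-\Pi_kC^\top Q_k^{-1}C\Pi_k+BR_kB^\top$, $\Pi_k(0)=\Gamma_k$ (symmetric positive definite for all $t$), $P_k(t)=\Pi_k(t)^{-1}$ (infinitely differentiable in $t$), and $\widehat{x}_k\in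 H^1(0,T;\mathbb{R}^n)$ solves $\dot{\widehat{x}}_k=A_k\widehat{x}_k+\Pi_kC^\top Q_k^{-1}(y-C\widehat{x}_k)$, $\widehat{x}_k(0)=x_0$. Set $r_k(t)=\int_0^t\|y(s)-C\widehat{x}_k(s)\|_{Q_k^{-1}}^2\,ds$ and $\mathcal{V}_k(t,x)=\|x-\widehat{x}_k(t)\|_{P_k(t)}^2+r_k(t)$. For $t\in[0,T]$, the worst case minimizer $\widehat{x}_\infty(t)$ is the unique minimizer over $x\in\mathbb{R}^n$ of $\max_{k=1,\dots,N}\mathcal{V}_k(t,x)$. *)

theory Defs
  imports "HOL-Analysis.Analysis" "HOL-Probability.Essential_Supremum"
begin

definition sym_posdef :: "real^'n^'n \<Rightarrow> bool" where
  "sym_posdef M \<longleftrightarrow> transpose M = M \<and> (\<forall>x. x \<noteq> 0 \<longrightarrow> 0 < x \<bullet> (M *v x))"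

definition wnorm_sq :: "real^'n^'n \<Rightarrow> real^'n \<Rightarrow> real" where
  "wnorm_sq M x = x \<bullet> (M *v x)"

text \<open>Elements of the Lebesgue spaces are functions rather than equivalence classes.\<close>

definition L2_space :: "'a measure \<Rightarrow> ('a \<Rightarrow> 'b::euclidean_space) set" where
  "L2_space M = {f \<in> borel_measurable M. integrable M (\<lambda>t. (norm (f t))\<^sup>2)}"

definition Linf_space :: "'a measure \<Rightarrow> ('a \<Rightarrow> 'b::euclidean_space) set" where
  "Linf_space M = {f \<in> borel_measurable M. esssup M (\<lambda>t. ereal (norm (f t))) < \<infinity>}"

definition ess_bounded :: "'a measure \<Rightarrow> ('a \<Rightarrow> 'b::euclidean_space) \<Rightarrow> bool" where
  "ess_bounded M f \<longleftrightarrow> (\<exists>K::real. AE t in M. norm (f t) \<le> K)"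

definition test_function :: "real \<Rightarrow> (real \<Rightarrow> real) \<Rightarrow> bool" where
  "test_function T \<phi> \<longleftrightarrow>
     (\<forall>j t. ((deriv ^^ j) \<phi>) field_differentiable (at t)) \<and>
     (\<exists>a b. 0 < a \<and> b < T \<and> (\<forall>t. t \<notin> {a..b} \<longrightarrow> \<phi> t = 0))"

definition loc_integrable :: "real \<Rightarrow> (real \<Rightarrow> 'b::euclidean_space) \<Rightarrow> bool" where
  "loc_integrable T f \<longleftrightarrow>
     (\<forall>a b. 0 < a \<and> b < T \<longrightarrow> set_integrable lebesgue {a..b} f)"

definition has_weak_derivative ::
    "real \<Rightarrow> (real \<Rightarrow> 'b::euclidean_space) \<Rightarrow> (real \<Rightarrow> 'b) \<Rightarrow> bool" where
  "has_weak_derivative T f g \<longleftrightarrow>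
     loc_integrable T f \<and> loc_integrable T g \<and>
     (\<forall>\<phi>. test_function T \<phi> \<longrightarrow>
        (LINT t:{0<..<T}|lebesgue. deriv \<phi> t *\<^sub>R f t) =
        - (LINT t:{0<..<T}|lebesgue. \<phi> t *\<^sub>R g t))"

text \<open>An element of the Sobolev space \<open>H\<^sup>1(0,T)\<close> has a unique representative that is continuous
  on \<open>[0,T]\<close>. Point values such as initial conditions refer to that representative, so the
  set below consists of exactly these representatives.\<close>

definition H1_space :: "real \<Rightarrow> (real \<Rightarrow> 'b::euclidean_space) set" where
  "H1_space T = {f. continuous_on {0..T} f \<and>
     f \<in> L2_space (lebesgue_on {0<..<T}) \<and>
     (\<exists>g \<in> L2_space (lebesgue_on {0<..<T}). has_weak_derivative T f g)}"

definition riccati_solution ::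
    "real \<Rightarrow> real^'n^'n \<Rightarrow> real^'m^'n \<Rightarrow> real^'n^'r \<Rightarrow>
     real^'n^'n \<Rightarrow> real^'m^'m \<Rightarrow> real^'r^'r \<Rightarrow> (real \<Rightarrow> real^'n^'n) \<Rightarrow> bool" where
  "riccati_solution T A B C \<Gamma> R Q Ric \<longleftrightarrow>
     Ric 0 = \<Gamma> \<and>
     (\<forall>t\<in>{0..T}. (Ric has_vector_derivative
        (A ** Ric t + Ric t ** transpose A
          - Ric t ** transpose C ** matrix_inv Q ** C ** Ric t
          + B ** R ** transpose B)) (at t within {0..T}))"

text \<open>The measured output \<open>y\<close> is only square integrable, so the observer equation holds in the
  weak (equivalently, almost everywhere) sense.\<close>

definition observer_solution ::
    "real \<Rightarrow> real^'n^'n \<Rightarrow> real^'n^'r \<Rightarrow> real^'r^'r \<Rightarrow> real^'n \<Rightarrow> (real \<Rightarrow> real^'r) \<Rightarrow>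
     (real \<Rightarrow> real^'n^'n) \<Rightarrow> (real \<Rightarrow> real^'n) \<Rightarrow> bool" where
  "observer_solution T A C Q x0 y Ric xh \<longleftrightarrow>
     xh \<in> H1_space T \<and> xh 0 = x0 \<and>
     has_weak_derivative T xh
       (\<lambda>t. A *v xh t + (Ric t ** transpose C ** matrix_inv Q) *v (y t - C *v xh t))"

definition output_residual ::
    "real^'n^'r \<Rightarrow> real^'r^'r \<Rightarrow> (real \<Rightarrow> real^'r) \<Rightarrow> (real \<Rightarrow> real^'n) \<Rightarrow> real \<Rightarrow> real" where
  "output_residual C Q y xh t =
     (LINT s:{0..t}|lebesgue. wnorm_sq (matrix_inv Q) (y s - C *v xh s))"

definition value_fn ::
    "real^'n^'r \<Rightarrow> real^'r^'r \<Rightarrow> (real \<Rightarrow> real^'r) \<Rightarrow>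
     (real \<Rightarrow> real^'n^'n) \<Rightarrow> (real \<Rightarrow> real^'n) \<Rightarrow> real \<Rightarrow> real^'n \<Rightarrow> real" where
  "value_fn C Q y Ric xh t x =
     wnorm_sq (matrix_inv (Ric t)) (x - xh t) + output_residual C Q y xh t"

definition worst_case_minimizer ::
    "'k set \<Rightarrow> ('k \<Rightarrow> real \<Rightarrow> real^'n \<Rightarrow> real) \<Rightarrow> real \<Rightarrow> real^'n" where
  "worst_case_minimizer S V t =
     (THE x. is_arg_min (\<lambda>z. MAX k\<in>S. V k t z) (\<lambda>_. True) x)"

end

theory Submission
  imports Defs
begin

text \<open>The worst case minimizer is in fact continuous on \<open>[0,T]\<close>, and a continuous function on a compact
  interval is measurable and bounded.

  Continuity comes from convexity and compactness. For each \<open>t\<close> the function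
  \<open>x \<mapsto> max\<^sub>k V\<^sub>k t x\<close> is a maximum of finitely many strictly convex quadratics, so it has exactly one
  minimizer, and the quadratic growth of any one \<open>V\<^sub>k\<close>, which is uniform in \<open>t\<close>, keeps all the
  minimizers in a fixed ball. Since the maximum is jointly continuous in \<open>(t, x)\<close>, the graph of the
  minimizer is closed, and a closed graph over \<open>[0,T]\<close> inside a compact ball is the graph of a
  continuous function (\<open>continuous_on_arg_min\<close>, \<open>continuous_on_worst_case_minimizer\<close>).

  It remains to see that the data of \<open>V\<^sub>k\<close> are continuous in \<open>t\<close>. The observer is continuous because
  elements of \<open>H\<^sup>1\<close> are represented by continuous functions, and the residual is an indefinite
  integral of an integrable function (\<open>output_residual_continuous\<close>). The weight is the inverse of the
  Riccati solution, so the main point is that this solution stays symmetric positive definite on the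
  whole interval. Symmetry is a uniqueness argument (\<open>riccati_symmetric\<close>). For definiteness
  (\<open>riccati_posdef\<close>), the equation is only inspected at the first moment and in the direction
  in which the form, multiplied by a suitable exponential, would touch a small positive level. That
  direction is an eigenvector, and there the equation forces the weighted form to increase, which
  excludes such a moment.\<close>

section \<open>Quadratic forms and matrix inverses\<close>
lemma transpose_add: "transpose (M + N) = transpose M + transpose N" for M N :: "'a::plus^'n^'m"
  by (simp add: transpose_def vec_eq_iff)

lemma bilinear_matrix_vector_mult: "bilinear ((*v) :: real^'n^'m \<Rightarrow> real^'n \<Rightarrow> real^'m)"
  by (auto simp: bilinear_def matrix_vector_mult_add_rdistrib matrix_vector_right_distrib
      scaleR_matrix_vector_assoc matrix_vector_mult_scaleR intro!: linearI)

lemma bounded_bilinear_matrix_vector_mult: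
  "bounded_bilinear ((*v) :: real^'n^'m \<Rightarrow> real^'n \<Rightarrow> real^'m)"
  using bilinear_matrix_vector_mult by (simp add: bilinear_conv_bounded_bilinear)

lemma bounded_bilinear_matrix_matrix_mult:
  "bounded_bilinear ((**) :: real^'n^'m \<Rightarrow> real^'k^'n \<Rightarrow> real^'k^'m)"
  unfolding bilinear_conv_bounded_bilinear[symmetric]
  by (auto simp: bilinear_def matrix_matrix_mult_def vec_eq_iff algebra_simps sum.distrib
      sum_distrib_left intro!: linearI)

lemmas continuous_on_matrix_vector_mult [continuous_intros] =
  bounded_bilinear.continuous_on[OF bounded_bilinear_matrix_vector_mult]
lemmas continuous_on_matrix_matrix_mult [continuous_intros] =
  bounded_bilinear.continuous_on[OF bounded_bilinear_matrix_matrix_mult]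

lemma bounded_linear_transpose: "bounded_linear (transpose :: real^'n^'m \<Rightarrow> real^'m^'n)"
  by (intro linear_conv_bounded_linear[THEN iffD1] linearI) (simp_all add: transpose_add transpose_scalar)

lemma inner_matrix_vector_transpose: "x \<bullet> (M *v y) = (transpose M *v x) \<bullet> y"
  for M :: "real^'n^'m"
  by (metis dot_lmul_matrix transpose_transpose vector_transpose_matrix)

lemma wnorm_sq_scaleR: "wnorm_sq M (a *\<^sub>R x) = a\<^sup>2 * wnorm_sq M x"
  by (simp add: wnorm_sq_def matrix_vector_mult_scaleR power2_eq_square)

lemma wnorm_sq_midpoint:
  "wnorm_sq M ((1/2) *\<^sub>R (x + y)) = (wnorm_sq M x + wnorm_sq M y) / 2 - wnorm_sq M (x - y) / 4"
  by (simp add: wnorm_sq_def matrix_vector_mult_scaleR matrix_vector_mult_diff_distrib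
      matrix_vector_right_distrib algebra_simps inner_add_left inner_add_right inner_diff_left
      inner_diff_right add_divide_distrib diff_divide_distrib)

lemma continuous_on_wnorm_sq [continuous_intros]:
  assumes "continuous_on S M" "continuous_on S x"
  shows "continuous_on S (\<lambda>s. wnorm_sq (M s) (x s))"
  unfolding wnorm_sq_def by (intro continuous_intros assms)

lemma wnorm_sq_pos: "sym_posdef M \<Longrightarrow> x \<noteq> 0 \<Longrightarrow> 0 < wnorm_sq M x"
  by (simp add: sym_posdef_def wnorm_sq_def)

lemma sym_posdef_invertible:
  fixes M :: "real^'n^'n"
  assumes "sym_posdef M" shows "invertible M"
proof -
  have "x = 0" if "M *v x = 0" for x
    using wnorm_sq_pos[OF assms, of x] that by (auto simp: wnorm_sq_def)
  then show ?thesis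
    by (metis invertible_left_inverse matrix_left_invertible_ker)
qed

lemma matrix_inv_cancel:
  fixes M :: "real^'n^'n"
  assumes "invertible M" shows "matrix_inv M ** M = mat 1" "M ** matrix_inv M = mat 1"
  using someI_ex[OF assms[unfolded invertible_def]] by (simp_all add: matrix_inv_def)

text \<open>With \<open>z = matrix_inv M *v x\<close>, the form of the inverse at \<open>x\<close> is the form of \<open>M\<close> at \<open>z\<close>.\<close>
lemma sym_posdef_matrix_inv:
  fixes M :: "real^'n^'n"
  assumes "sym_posdef M" shows "sym_posdef (matrix_inv M)"
proof -
  note inv = matrix_inv_cancel[OF sym_posdef_invertible[OF assms]]
  have sym: "transpose M = M"
    using assms by (simp add: sym_posdef_def)
  have "transpose (matrix_inv M) ** M = mat 1"
    using arg_cong[OF inv(2), of transpose] by (simp add: matrix_transpose_mul sym)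
  then have "transpose (matrix_inv M) = matrix_inv M"
    by (metis inv(2) matrix_mul_assoc matrix_mul_lid matrix_mul_rid)
  moreover have "0 < x \<bullet> (matrix_inv M *v x)" if "x \<noteq> 0" for x
  proof -
    let ?z = "matrix_inv M *v x"
    have x: "x = M *v ?z"
      by (simp add: matrix_vector_mul_assoc inv)
    then have "?z \<noteq> 0"
      using that by force
    then show ?thesis
      using wnorm_sq_pos[OF assms, of ?z] x by (simp add: wnorm_sq_def inner_commute)
  qed
  ultimately show ?thesis
    by (simp add: sym_posdef_def)
qed

lemma continuous_on_det:
  fixes M :: "'a::topological_space \<Rightarrow> real^'n^'n"
  assumes "\<And>i j. continuous_on S (\<lambda>s. M s $ i $ j)"
  shows "continuous_on S (\<lambda>s. det (M s))"
  unfolding det_def by (intro continuous_intros assms)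

text \<open>Writing the entries as quotients of determinants makes continuity of the inversion an instance
  of the continuity of polynomials.\<close>
lemma matrix_inv_cramer:
  fixes M :: "real^'n^'n"
  assumes "invertible M"
  shows "matrix_inv M = (\<chi> i k. det (\<chi> a b. if b = i then axis k 1 $ a else M $ a $ b) / det M)"
proof -
  have "M *v (matrix_inv M *v axis k 1) = axis k 1" for k
    by (simp add: matrix_vector_mul_assoc matrix_inv_cancel[OF assms])
  then have "matrix_inv M *v axis k 1 =
      (\<chi> i. det (\<chi> a b. if b = i then axis k 1 $ a else M $ a $ b) / det M)" for k
    using assms by (subst cramer[symmetric]) (auto simp: invertible_det_nz)
  then have "(matrix_inv M *v axis k 1) $ i =
      det (\<chi> a b. if b = i then axis k 1 $ a else M $ a $ b) / det M" for k i
    by simp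
  then show ?thesis
    by (simp add: vec_eq_iff matrix_vector_mul_component inner_axis)
qed

lemma continuous_on_matrix_inv:
  fixes M :: "'a::topological_space \<Rightarrow> real^'n^'n"
  assumes M: "continuous_on S M" and inv: "\<And>s. s \<in> S \<Longrightarrow> invertible (M s)"
  shows "continuous_on S (\<lambda>s. matrix_inv (M s))"
proof -
  have entry: "continuous_on S (\<lambda>s. if b = i then c else M s $ a $ b)" for a b i :: 'n and c
    using M by (cases "b = i") (auto intro!: continuous_intros)
  have "continuous_on S (\<lambda>s. (\<chi> i k. det (\<chi> a b. if b = i then axis k 1 $ a else M s $ a $ b)
      / det (M s)) :: real^'n^'n)"
    using inv by (intro continuous_intros continuous_on_det)
      (auto simp: invertible_det_nz intro!: entry M continuous_on_det continuous_on_component)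
  then show ?thesis
    by (rule continuous_on_eq) (simp add: matrix_inv_cramer[OF inv])
qed

text \<open>If \<open>M x\<close> were nonzero, moving from \<open>x\<close> a little in the direction \<open>- M x\<close> would decrease the
  form at first order, below its minimum \<open>0\<close>. This is how a minimizing direction of a symmetric
  form is recognized as an eigenvector.\<close>
lemma psd_null_vector:
  fixes M :: "real^'n^'n"
  assumes sym: "transpose M = M" and psd: "\<And>z. 0 \<le> wnorm_sq M z" and x: "wnorm_sq M x = 0"
  shows "M *v x = 0"
proof (rule ccontr)
  let ?v = "M *v x"
  assume nz: "?v \<noteq> 0"
  define a b where "a = ?v \<bullet> ?v" and "b = wnorm_sq M ?v"
  have "a > 0" "b \<ge> 0"
    using nz psd by (simp_all add: a_def b_def)
  have "x \<bullet> (M *v ?v) = a"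
    by (simp add: a_def inner_matrix_vector_transpose[of x] sym)
  then have expand: "wnorm_sq M (x - s *\<^sub>R ?v) = s\<^sup>2 * b - 2 * s * a" for s
    using x by (simp add: wnorm_sq_def b_def a_def matrix_vector_mult_scaleR
        matrix_vector_mult_diff_distrib inner_diff_left inner_diff_right algebra_simps power2_eq_square)
  \<comment> \<open>The step length must satisfy \<open>s * b < 2 * a\<close>; adding \<open>1\<close> covers the case \<open>b = 0\<close>.\<close>
  define s where "s = a / (b + 1)"
  have "s > 0" "s * b < a"
    using \<open>a > 0\<close> \<open>b \<ge> 0\<close> by (simp_all add: s_def field_simps)
  then have "s * (s * b) < s * (2 * a)"
    using \<open>a > 0\<close> by (intro mult_strict_left_mono) auto
  with psd[of "x - s *\<^sub>R ?v"] show False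
    unfolding expand by (simp add: power2_eq_square mult.assoc mult.left_commute)
qed

text \<open>The form is continuous and positive on the compact set \<open>I \<times> sphere 0 1\<close>, hence bounded away
  from zero there; homogeneity extends the bound to all vectors.\<close>
lemma uniformly_coercive:
  fixes M :: "'a::t2_space \<Rightarrow> real^'n^'n"
  assumes "compact I" "continuous_on I M" and pd: "\<And>s. s \<in> I \<Longrightarrow> sym_posdef (M s)"
  obtains \<alpha> where "\<alpha> > 0" "\<And>s x. s \<in> I \<Longrightarrow> \<alpha> * (norm x)\<^sup>2 \<le> wnorm_sq (M s) x"
proof (cases "I = {}")
  case True
  then show ?thesis
    using that[of 1] by simp
next
  case False
  have "continuous_on (I \<times> sphere 0 1) (\<lambda>p. wnorm_sq (M (fst p)) (snd p))"
    by (intro continuous_intros continuous_on_compose2[OF assms(2)]) auto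
  moreover have "compact (I \<times> sphere (0::real^'n) 1)"
    by (intro compact_Times assms(1) compact_sphere)
  moreover have "I \<times> sphere (0::real^'n) 1 \<noteq> {}"
    using False by (auto intro!: exI[of _ "axis undefined 1"])
  ultimately obtain p where p: "p \<in> I \<times> sphere 0 1" and
    min: "\<And>q. q \<in> I \<times> sphere 0 1 \<Longrightarrow>
        wnorm_sq (M (fst p)) (snd p) \<le> wnorm_sq (M (fst q)) (snd q)"
    using continuous_attains_inf[of "I \<times> sphere (0::real^'n) 1"] by (metis (no_types, lifting))
  show ?thesis
  proof
    show "0 < wnorm_sq (M (fst p)) (snd p)"
      using p by (intro wnorm_sq_pos pd) auto
    fix s x assume s: "s \<in> I"
    show "wnorm_sq (M (fst p)) (snd p) * (norm x)\<^sup>2 \<le> wnorm_sq (M s) x"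
    proof (cases "x = 0")
      case False
      have "wnorm_sq (M (fst p)) (snd p) \<le> wnorm_sq (M s) ((1 / norm x) *\<^sub>R x)"
        using min[of "(s, (1 / norm x) *\<^sub>R x)"] s False by simp
      then show ?thesis
        using False unfolding wnorm_sq_scaleR by (simp add: field_simps power2_eq_square)
    qed (simp add: wnorm_sq_def)
  qed
qed

section \<open>Positive definiteness along the Riccati flow\<close>

text \<open>The bound makes \<open>exp (- 2 * K * s) * (norm (D s))\<^sup>2\<close> nonincreasing in \<open>s\<close>, and this quantity
  is nonnegative and starts at zero.\<close>
lemma gronwall_zero:
  fixes D :: "real \<Rightarrow> 'v::real_inner"
  assumes der: "\<And>t. t \<in> {0..T} \<Longrightarrow> (D has_vector_derivative D' t) (at t within {0..T})"
    and bound: "\<And>t. t \<in> {0..T} \<Longrightarrow> norm (D' t) \<le> K * norm (D t)"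
    and "D 0 = 0" and t: "t \<in> {0..T}"
  shows "D t = 0"
proof (cases "t = 0")
  case False
  define g where "g s = exp (- 2 * K * s) * (D s \<bullet> D s)" for s
  have g': "(g has_real_derivative exp (- 2 * K * s) * (2 * (D s \<bullet> D' s) - 2 * K * (D s \<bullet> D s)))
      (at s within {0..T})" if "s \<in> {0..T}" for s
  proof -
    have "((\<lambda>s. D s \<bullet> D s) has_vector_derivative D s \<bullet> D' s + D' s \<bullet> D s) (at s within {0..T})"
      by (rule bounded_bilinear.has_vector_derivative[OF bounded_bilinear_inner der[OF that] der[OF that]])
    then have "((\<lambda>s. D s \<bullet> D s) has_real_derivative D s \<bullet> D' s + D' s \<bullet> D s) (at s within {0..T})"
      by (simp add: has_real_derivative_iff_has_vector_derivative)
    then show ?thesis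
      unfolding g_def
      by (auto intro!: derivative_eq_intros simp: inner_commute algebra_simps)
  qed
  have "g t \<le> g 0"
  proof (rule DERIV_nonpos_imp_decreasing_open[where f = g])
    show "0 \<le> t" using t by simp
    have "continuous_on {0..T} g"
      using g' by (rule DERIV_continuous_on)
    then show "continuous_on {0..t} g"
      by (rule continuous_on_subset) (use t in auto)
    fix s assume s: "0 < s" "s < t"
    have "D s \<bullet> D' s \<le> norm (D s) * norm (D' s)"
      by (rule norm_cauchy_schwarz)
    also have "\<dots> \<le> norm (D s) * (K * norm (D s))"
      using bound[of s] s t by (intro mult_left_mono) auto
    finally have "2 * (D s \<bullet> D' s) - 2 * K * (D s \<bullet> D s) \<le> 0"
      by (simp add: dot_square_norm power2_eq_square algebra_simps)
    moreover have "at s within {0..T} = at s"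
      using s t by (intro at_within_interior) simp
    ultimately show "\<exists>y. DERIV g s :> y \<and> y \<le> 0"
      using g'[of s] s t
      by (intro exI conjI, simp) (auto intro: mult_nonneg_nonpos)
  qed
  then have "D t \<bullet> D t \<le> 0"
    using \<open>D 0 = 0\<close> by (simp add: g_def mult_le_0_iff)
  then show ?thesis
    by (metis inner_gt_zero_iff not_less)
qed (use \<open>D 0 = 0\<close> in simp)

text \<open>The transpose solves the same equation, and the difference \<open>D\<close> of the two solutions satisfies
  the linear equation \<open>D' = F D + D G\<close>, with bounded coefficients \<open>F = A - P S\<close> and
  \<open>G = transpose A - S (transpose P)\<close>, because
  \<open>P S P - P\<^sup>T S P\<^sup>T = P S D + D S P\<^sup>T\<close>.\<close>
lemma riccati_symmetric:
  fixes P :: "real \<Rightarrow> real^'n^'n"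
  assumes der: "\<And>t. t \<in> {0..T} \<Longrightarrow> (P has_vector_derivative
        A ** P t + P t ** transpose A - P t ** S ** P t + W) (at t within {0..T})"
    and S: "transpose S = S" and W: "transpose W = W" and P0: "transpose (P 0) = P 0"
    and t: "t \<in> {0..T}"
  shows "transpose (P t) = P t"
proof -
  interpret mm: bounded_bilinear "(**) :: real^'n^'n \<Rightarrow> real^'n^'n \<Rightarrow> real^'n^'n"
    by (rule bounded_bilinear_matrix_matrix_mult)
  note tr = bounded_linear_transpose[where 'n='n and 'm='n]
  define D where "D t = P t - transpose (P t)" for t
  define F where "F t = A - P t ** S" for t
  define G where "G t = transpose A - S ** transpose (P t)" for t
  have D': "(D has_vector_derivative F t ** D t + D t ** G t) (at t within {0..T})"
    if t: "t \<in> {0..T}" for t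
  proof -
    let ?P' = "A ** P t + P t ** transpose A - P t ** S ** P t + W"
    have "(D has_vector_derivative ?P' - transpose ?P') (at t within {0..T})"
      unfolding D_def
      by (intro has_vector_derivative_diff bounded_linear.has_vector_derivative[OF tr] der t)
    also have "transpose ?P' = transpose (P t) ** transpose A + A ** transpose (P t)
        - transpose (P t) ** S ** transpose (P t) + W"
      by (simp add: bounded_linear.linear[OF tr] linear_add linear_diff matrix_transpose_mul S W
          matrix_mul_assoc)
    also have "?P' - \<dots> = F t ** D t + D t ** G t"
      by (simp add: F_def G_def D_def mm.diff_left mm.diff_right matrix_mul_assoc)
    finally show ?thesis .
  qed
  obtain k where k: "\<And>M N. norm (M ** N :: real^'n^'n) \<le> norm (M::real^'n^'n) * norm (N::real^'n^'n) * k"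
    and "k \<ge> 0"
    using mm.nonneg_bounded by blast
  have contP: "continuous_on {0..T} P"
    using der by (rule continuous_on_vector_derivative)
  have "continuous_on {0..T} (\<lambda>t. norm (F t) + norm (G t))"
    unfolding F_def G_def
    by (intro continuous_intros contP bounded_linear.continuous_on[OF tr])
  then have "bounded ((\<lambda>t. norm (F t) + norm (G t)) ` {0..T})"
    by (intro compact_imp_bounded compact_continuous_image) auto
  then obtain K where K: "\<And>t. t \<in> {0..T} \<Longrightarrow> norm (F t) + norm (G t) \<le> K"
    by (force simp: bounded_iff)
  have "norm (F t ** D t + D t ** G t) \<le> K * k * norm (D t)" if "t \<in> {0..T}" for t
  proof -
    have "norm (F t ** D t + D t ** G t)
        \<le> norm (F t) * norm (D t) * k + norm (D t) * norm (G t) * k"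
      by (intro norm_triangle_le add_mono k)
    also have "\<dots> = (norm (F t) + norm (G t)) * (k * norm (D t))"
      by (simp add: algebra_simps)
    also have "\<dots> \<le> K * (k * norm (D t))"
      using K[OF that] \<open>k \<ge> 0\<close> by (intro mult_right_mono) auto
    finally show ?thesis by (simp add: mult.assoc)
  qed
  from gronwall_zero[OF D' this _ t] have "D t = 0"
    using P0 by (simp add: D_def)
  then show ?thesis by (simp add: D_def)
qed

lemma wnorm_sq_bounded:
  fixes M :: "real^'n^'n"
  obtains K where "K > 0" "\<And>x. \<bar>wnorm_sq M x\<bar> \<le> K * (norm x)\<^sup>2"
proof -
  obtain K where "K > 0" and K: "\<And>x. norm (M *v x) \<le> norm x * K"
    using bounded_linear.pos_bounded[OF matrix_vector_mul_bounded_linear[of M]] by blast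
  have "\<bar>wnorm_sq M x\<bar> \<le> K * (norm x)\<^sup>2" for x
  proof -
    have "\<bar>wnorm_sq M x\<bar> \<le> norm x * norm (M *v x)"
      unfolding wnorm_sq_def by (rule Cauchy_Schwarz_ineq2)
    also have "\<dots> \<le> norm x * (norm x * K)"
      by (intro mult_left_mono K) simp
    finally show ?thesis by (simp add: power2_eq_square mult_ac)
  qed
  with \<open>K > 0\<close> that show thesis by blast
qed

text \<open>In the direction of an eigenvector of \<open>P\<close>, each term of the right-hand side that contains \<open>P\<close>
  carries the eigenvalue as a factor. So if \<open>W\<close> is positive semidefinite, a small eigenvalue decreases
  at most at a rate proportional to itself.\<close>
lemma riccati_derivative_eigenvector:
  fixes P :: "real^'n^'n"
  assumes "P *v x = l *\<^sub>R x" "transpose P = P"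
  shows "wnorm_sq (A ** P + P ** transpose A - P ** S ** P + W) x
       = 2 * l * wnorm_sq A x - l\<^sup>2 * wnorm_sq S x + wnorm_sq W x"
proof -
  have 1: "x \<bullet> (A *v (P *v x)) = l * wnorm_sq A x"
    by (simp add: assms wnorm_sq_def matrix_vector_mult_scaleR)
  have Px: "x \<bullet> (P *v z) = l * (x \<bullet> z)" for z
    by (metis assms inner_matrix_vector_transpose inner_scaleR_left)
  have 2: "x \<bullet> (P *v (transpose A *v x)) = l * wnorm_sq A x"
    by (metis Px wnorm_sq_def inner_matrix_vector_transpose inner_commute)
  have 3: "x \<bullet> (P *v (S *v (P *v x))) = l\<^sup>2 * wnorm_sq S x"
    by (simp add: Px assms(1) wnorm_sq_def matrix_vector_mult_scaleR power2_eq_square)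
  show ?thesis
    using 1 2 3 by (simp add: wnorm_sq_def matrix_vector_mult_add_rdistrib
        matrix_vector_mult_diff_rdistrib inner_add_right inner_diff_right
        flip: matrix_vector_mul_assoc)
qed

text \<open>Suppose that the form of \<open>exp (k t) P t\<close> on unit vectors reached a level \<open>c\<close> strictly below its
  initial minimum, and take the first time \<open>\<tau>\<close> at which this happens, in a direction \<open>x\<close>. Then \<open>x\<close>
  minimizes the form at time \<open>\<tau>\<close>, so it is an eigenvector of \<open>P \<tau>\<close> with a positive eigenvalue. In
  that direction the exponential weight dominates the terms of the Riccati equation, so the weighted
  form is strictly increasing at \<open>\<tau>\<close>. Hence it was below \<open>c\<close> before \<open>\<tau>\<close>, a contradiction.\<close>
lemma riccati_posdef:
  fixes P :: "real \<Rightarrow> real^'n^'n"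
  assumes der: "\<And>t. t \<in> {0..T} \<Longrightarrow> (P has_vector_derivative
        A ** P t + P t ** transpose A - P t ** S ** P t + W) (at t within {0..T})"
    and S: "transpose S = S" and W: "transpose W = W" "\<And>x. 0 \<le> wnorm_sq W x"
    and P0: "sym_posdef (P 0)" and t: "t \<in> {0..T}"
  shows "sym_posdef (P t)"
proof -
  have sym: "transpose (P t) = P t" if "t \<in> {0..T}" for t
    using P0 by (intro riccati_symmetric[OF der S W(1) _ that]) (auto simp: sym_posdef_def)
  have contP: "continuous_on {0..T} P"
    using der by (rule continuous_on_vector_derivative)
  obtain c2 where "c2 > 0" and c2: "\<And>x. c2 * (norm x)\<^sup>2 \<le> wnorm_sq (P 0) x"
    using uniformly_coercive[of "{0::real}" P] P0 by (metis (no_types, lifting)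
        compact_sing continuous_on_sing singletonD singletonI)
  define c where "c = c2 / 2"
  have "c > 0" using \<open>c2 > 0\<close> by (simp add: c_def)
  obtain a where "a > 0" and a: "\<And>x. \<bar>wnorm_sq A x\<bar> \<le> a * (norm x)\<^sup>2"
    using wnorm_sq_bounded[of A] by blast
  obtain b where "b > 0" and b: "\<And>x. \<bar>wnorm_sq S x\<bar> \<le> b * (norm x)\<^sup>2"
    using wnorm_sq_bounded[of S] by blast
  \<comment> \<open>At the critical time the eigenvalue \<open>l\<close> is at most \<open>c\<close>, so the drift is at least
    \<open>- (2 * a + c * b) * l\<close>; the summand \<open>1\<close> makes the weight win strictly.\<close>
  define k where "k = 2 * a + c * b + 1"
  have "k > 0"
    using \<open>a > 0\<close> \<open>b > 0\<close> \<open>c > 0\<close> by (simp add: k_def add_pos_pos)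
  define h where "h s x = exp (k * s) * wnorm_sq (P s) x" for s x
  define Z where "Z = {p \<in> {0..T} \<times> sphere 0 1. h (fst p) (snd p) \<le> c}"
  have conth: "continuous_on ({0..T} \<times> sphere 0 1) (\<lambda>p. h (fst p) (snd p))"
    unfolding h_def by (intro continuous_intros continuous_on_compose2[OF contP]) auto
  have "Z = {}"
  proof (rule ccontr)
    assume "Z \<noteq> {}"
    have "closed Z"
      unfolding Z_def
      using conth by (intro continuous_on_closed_Collect_le closed_Times) (auto intro: continuous_intros)
    moreover have "bounded Z"
      by (rule bounded_subset[of "{0..T} \<times> sphere 0 1"]) (auto simp: Z_def intro: bounded_Times)
    ultimately have "compact Z"
      by (simp add: compact_eq_bounded_closed)
    then obtain p where "p \<in> Z" and first: "\<And>q. q \<in> Z \<Longrightarrow> fst p \<le> fst q"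
      using continuous_attains_inf[of Z fst] \<open>Z \<noteq> {}\<close> continuous_on_fst[OF continuous_on_id] by blast
    obtain \<tau> x where p: "p = (\<tau>, x)" by (cases p)
    have \<tau>: "\<tau> \<in> {0..T}" and x: "norm x = 1" and hx: "h \<tau> x \<le> c"
      using \<open>p \<in> Z\<close> by (auto simp: Z_def p)
    have before: "c < h s z" if "0 \<le> s" "s < \<tau>" "norm z = 1" for s z
      using first[of "(s, z)"] that \<tau> by (force simp: Z_def p)
    have "\<tau> \<noteq> 0"
      using c2[of x] hx x \<open>c2 > 0\<close> by (auto simp: h_def c_def)
    with \<tau> have "\<tau> > 0" by simp
    have at_\<tau>: "c \<le> h \<tau> z" if z: "norm z = 1" for z
    proof -
      have "continuous_on {0..\<tau>} (\<lambda>s. h s z)"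
        unfolding h_def using \<tau> by (intro continuous_intros continuous_on_subset[OF contP]) auto
      then have "((\<lambda>s. h s z) \<longlongrightarrow> h \<tau> z) (at \<tau> within {0..\<tau>})"
        using \<open>\<tau> > 0\<close> by (auto simp: continuous_on_def)
      then have "((\<lambda>s. h s z) \<longlongrightarrow> h \<tau> z) (at_left \<tau>)"
        using \<open>\<tau> > 0\<close> at_within_Icc_at_left by metis
      then show ?thesis
      proof (rule tendsto_lowerbound)
        show "\<forall>\<^sub>F s in at_left \<tau>. c \<le> h s z"
          using eventually_at_left_real[OF \<open>\<tau> > 0\<close>]
          by eventually_elim (auto intro!: less_imp_le before z)
      qed simp
    qed
    \<comment> \<open>The unweighted level at time \<open>\<tau>\<close>, which is the least eigenvalue of \<open>P \<tau>\<close>.\<close>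
    define l where "l = c * exp (- k * \<tau>)"
    have "l > 0" "l \<le> c"
      using \<open>c > 0\<close> \<open>k > 0\<close> \<open>\<tau> > 0\<close> by (simp_all add: l_def)
    have hl: "h \<tau> z = exp (k * \<tau>) * (wnorm_sq (P \<tau> - l *\<^sub>R mat 1) z) + c * (norm z)\<^sup>2" for z
      by (simp add: h_def l_def wnorm_sq_def matrix_vector_mult_diff_rdistrib inner_diff_right
          dot_square_norm exp_minus field_simps flip: scaleR_matrix_vector_assoc)
    have psd: "0 \<le> wnorm_sq (P \<tau> - l *\<^sub>R mat 1) z" for z
    proof (cases "z = 0")
      case False
      let ?u = "(1 / norm z) *\<^sub>R z"
      have "0 \<le> exp (k * \<tau>) * wnorm_sq (P \<tau> - l *\<^sub>R mat 1) ?u"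
        using at_\<tau>[of ?u] hl[of ?u] False by simp
      then show ?thesis
        unfolding wnorm_sq_scaleR using False by (simp add: zero_le_mult_iff zero_le_divide_iff)
    qed (simp add: wnorm_sq_def)
    have "wnorm_sq (P \<tau> - l *\<^sub>R mat 1) x = 0"
      using psd[of x] hx hl[of x] x by (simp add: mult_le_0_iff not_less order_antisym)
    then have "(P \<tau> - l *\<^sub>R mat 1) *v x = 0"
      using psd sym[OF \<tau>]
      by (intro psd_null_vector)
        (simp_all add: linear_diff[OF bounded_linear.linear[OF bounded_linear_transpose]] transpose_scalar)
    then have eig: "P \<tau> *v x = l *\<^sub>R x"
      by (simp add: matrix_vector_mult_diff_rdistrib flip: scaleR_matrix_vector_assoc)
    let ?P' = "A ** P \<tau> + P \<tau> ** transpose A - P \<tau> ** S ** P \<tau> + W"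
    have "bounded_linear (\<lambda>M. wnorm_sq M x)"
      unfolding wnorm_sq_def
      by (intro bounded_linear_inner_right_comp
          bounded_bilinear.bounded_linear_left[OF bounded_bilinear_matrix_vector_mult])
    from bounded_linear.has_vector_derivative[OF this der[OF \<tau>]]
    have "((\<lambda>s. wnorm_sq (P s) x) has_real_derivative wnorm_sq ?P' x) (at \<tau> within {0..T})"
      by (simp add: has_real_derivative_iff_has_vector_derivative)
    then have "((\<lambda>s. h s x) has_real_derivative
        exp (k * \<tau>) * (k * wnorm_sq (P \<tau>) x + wnorm_sq ?P' x)) (at \<tau> within {0..T})"
      unfolding h_def by (auto intro!: derivative_eq_intros simp: algebra_simps)
    moreover have "0 < k * wnorm_sq (P \<tau>) x + wnorm_sq ?P' x"
    proof -
      have "- a \<le> wnorm_sq A x" "wnorm_sq S x \<le> b"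
        using a[of x] b[of x] x by auto
      then have "l * (- a) \<le> l * wnorm_sq A x" "l\<^sup>2 * wnorm_sq S x \<le> l\<^sup>2 * b"
        using \<open>l > 0\<close> by (intro mult_left_mono; simp)+
      moreover have "l\<^sup>2 * b \<le> l * (c * b)"
        using \<open>l > 0\<close> \<open>l \<le> c\<close> \<open>b > 0\<close> by (simp add: power2_eq_square)
      moreover have "k * wnorm_sq (P \<tau>) x = 2 * (l * a) + l * (c * b) + l"
        using eig x by (simp add: wnorm_sq_def dot_square_norm k_def algebra_simps)
      ultimately show ?thesis
        using W(2)[of x] \<open>l > 0\<close>
        unfolding riccati_derivative_eigenvector[OF eig sym[OF \<tau>]] by linarith
    qed
    ultimately obtain d where "d > 0" and d: "\<And>e. 0 < e \<Longrightarrow> \<tau> - e \<in> {0..T} \<Longrightarrow> e < d \<Longrightarrow>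
        h (\<tau> - e) x < h \<tau> x"
      using has_real_derivative_pos_inc_left[of "\<lambda>s. h s x", OF _ mult_pos_pos[OF exp_gt_zero]] by blast
    define e where "e = min (d / 2) (\<tau> / 2)"
    have "0 < e" "e < d" "e < \<tau>"
      using \<open>d > 0\<close> \<open>\<tau> > 0\<close> by (auto simp: e_def)
    then have "h (\<tau> - e) x < c" "c < h (\<tau> - e) x"
      using d[of e] \<tau> hx before[of "\<tau> - e" x] x by auto
    then show False by simp
  qed
  have "0 < wnorm_sq (P t) x" if "x \<noteq> 0" for x
  proof -
    let ?u = "(1 / norm x) *\<^sub>R x"
    have "c < h t ?u"
    proof (rule ccontr)
      assume "\<not> c < h t ?u"
      then have "(t, ?u) \<in> Z"
        using t that by (simp add: Z_def)
      with \<open>Z = {}\<close> show False by simp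
    qed
    then have "0 < wnorm_sq (P t) ?u"
      using \<open>c > 0\<close> by (simp add: h_def) (metis exp_gt_zero less_trans zero_less_mult_pos)
    then show ?thesis
      unfolding wnorm_sq_scaleR using that by (simp add: zero_less_mult_iff zero_less_divide_iff)
  qed
  then show ?thesis
    using sym[OF t] by (simp add: sym_posdef_def wnorm_sq_def)
qed

section \<open>Minimizers depending on a parameter\<close>
lemma continuous_on_MAX:
  fixes f :: "'k \<Rightarrow> 'a::topological_space \<Rightarrow> real"
  assumes "finite S" "S \<noteq> {}" "\<And>k. k \<in> S \<Longrightarrow> continuous_on D (f k)"
  shows "continuous_on D (\<lambda>s. MAX k\<in>S. f k s)"
  using assms
proof (induction S rule: finite_ne_induct)
  case (insert k S)
  then have "continuous_on D (\<lambda>s. max (f k s) (MAX k\<in>S. f k s))"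
    by (intro continuous_on_max) auto
  then show ?case
    using insert.hyps by simp
qed simp

text \<open>Coercivity confines the search to a compact ball, which gives existence. Two distinct minimizers
  would have a midpoint with a strictly smaller value.\<close>
lemma unique_arg_min:
  fixes f :: "'v::euclidean_space \<Rightarrow> real"
  assumes cont: "continuous_on UNIV f"
    and mid: "\<And>x y. x \<noteq> y \<Longrightarrow> f ((1/2) *\<^sub>R (x + y)) < (f x + f y) / 2"
    and coercive: "\<And>x. \<rho> < norm x \<Longrightarrow> f 0 < f x"
  obtains x where "norm x \<le> \<rho>" "is_arg_min f (\<lambda>_. True) x"
    "\<And>z. is_arg_min f (\<lambda>_. True) z \<Longrightarrow> z = x"
proof -
  have "0 \<le> \<rho>"
    using coercive[of 0] by force
  then obtain x where x: "x \<in> cball 0 \<rho>" and min: "\<And>z. z \<in> cball 0 \<rho> \<Longrightarrow> f x \<le> f z"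
    using continuous_attains_inf[of "cball 0 \<rho>" f] continuous_on_subset[OF cont] by auto
  have glob: "f x \<le> f z" for z
    using min[of z] min[of 0] coercive[of z] \<open>0 \<le> \<rho>\<close> by fastforce
  show ?thesis
  proof
    show "norm x \<le> \<rho>" using x by simp
    show "is_arg_min f (\<lambda>_. True) x"
      using glob by (simp add: is_arg_min_linorder)
    fix z assume "is_arg_min f (\<lambda>_. True) z"
    then have "f z = f x"
      using glob by (simp add: is_arg_min_linorder order_antisym)
    then show "z = x"
      using mid[of z x] glob[of "(1/2) *\<^sub>R (z + x)"] by (cases "z = x") auto
  qed
qed

text \<open>The graph of the minimizer is cut out by the closed conditions \<open>J t x \<le> J t z\<close>, one for each
  \<open>z\<close>. A map into a compact ball whose graph is closed over a closed set is continuous.\<close>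
lemma continuous_on_arg_min:
  fixes J :: "'a::euclidean_space \<Rightarrow> 'v::euclidean_space \<Rightarrow> real"
  assumes "closed I" and cont: "continuous_on (I \<times> UNIV) (\<lambda>p. J (fst p) (snd p))"
    and mid: "\<And>t x y. t \<in> I \<Longrightarrow> x \<noteq> y \<Longrightarrow> J t ((1/2) *\<^sub>R (x + y)) < (J t x + J t y) / 2"
    and coercive: "\<And>t x. t \<in> I \<Longrightarrow> \<rho> < norm x \<Longrightarrow> J t 0 < J t x"
  shows "continuous_on I (\<lambda>t. THE x. is_arg_min (J t) (\<lambda>_. True) x)"
proof -
  define m where "m t = (THE x. is_arg_min (J t) (\<lambda>_. True) x)" for t
  have sec: "continuous_on (I \<times> UNIV) (\<lambda>p. J (fst p) z)" for z
    using continuous_on_compose2[OF cont, of "I \<times> UNIV" "\<lambda>p. (fst p, z)"]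
    by (simp add: continuous_on_Pair continuous_on_fst image_subset_iff)
  have m: "norm (m t) \<le> \<rho>" "x = m t \<longleftrightarrow> (\<forall>z. J t x \<le> J t z)" if t: "t \<in> I" for t x
  proof -
    have "continuous_on UNIV (J t)"
      using continuous_on_compose2[OF cont, of UNIV "\<lambda>x. (t, x)"] t
      by (simp add: continuous_on_Pair image_subset_iff)
    then obtain x0 where x0: "norm x0 \<le> \<rho>" "is_arg_min (J t) (\<lambda>_. True) x0"
      "\<And>z. is_arg_min (J t) (\<lambda>_. True) z \<Longrightarrow> z = x0"
      using unique_arg_min[of "J t" \<rho>] mid[OF t] coercive[OF t] by blast
    then have "m t = x0"
      unfolding m_def by blast
    with x0 have "norm (m t) \<le> \<rho>" "x = m t \<longleftrightarrow> is_arg_min (J t) (\<lambda>_. True) x"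
      by blast+
    then show "norm (m t) \<le> \<rho>" "x = m t \<longleftrightarrow> (\<forall>z. J t x \<le> J t z)"
      by (simp_all add: is_arg_min_linorder)
  qed
  have "(\<lambda>t. (t, m t)) ` I = {p. fst p \<in> I \<and> snd p = m (fst p)}"
    by force
  also have "\<dots> = (\<Inter>z. {p \<in> I \<times> UNIV. J (fst p) (snd p) \<le> J (fst p) z})"
    by (rule set_eqI, simp add: mem_Times_iff, metis m(2))
  also have "closed \<dots>"
    by (intro closed_INT ballI continuous_on_closed_Collect_le cont sec closed_Times \<open>closed I\<close> closed_UNIV)
  finally have graph: "closed ((\<lambda>t. (t, m t)) ` I)" .
  have "m \<in> I \<rightarrow> cball 0 \<rho>"
    using m(1) by auto
  then have "continuous_on I m"
    by (rule continuous_from_closed_graph[OF compact_cball _ graph])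
  then show ?thesis
    unfolding m_def .
qed

text \<open>Strict midpoint convexity passes from the pieces to the maximum, because some piece is active
  at the midpoint and this piece is dominated by the maximum at both ends. A single piece suffices
  for coercivity: it is a lower bound for the maximum, and over the compact parameter set it grows
  quadratically with a uniform constant.\<close>
lemma continuous_on_worst_case_minimizer:
  fixes P :: "'k \<Rightarrow> 'a::euclidean_space \<Rightarrow> real^'n^'n" and r :: "'k \<Rightarrow> 'a \<Rightarrow> real"
  assumes "compact I" "finite S" "S \<noteq> {}"
    and P: "\<And>k. k \<in> S \<Longrightarrow> continuous_on I (P k)"
    and pd: "\<And>k t. k \<in> S \<Longrightarrow> t \<in> I \<Longrightarrow> sym_posdef (P k t)"
    and xh: "\<And>k. k \<in> S \<Longrightarrow> continuous_on I (xh k)"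
    and r: "\<And>k. k \<in> S \<Longrightarrow> continuous_on I (r k)"
  shows "continuous_on I (\<lambda>t. THE x. is_arg_min
    (\<lambda>x. MAX k\<in>S. wnorm_sq (P k t) (x - xh k t) + r k t) (\<lambda>_. True) x)"
proof -
  define V where "V k t x = wnorm_sq (P k t) (x - xh k t) + r k t" for k t x
  define J where "J t x = (MAX k\<in>S. V k t x)" for t x
  have V_le_J: "V k t x \<le> J t x" if "k \<in> S" for k t x
    unfolding J_def using that \<open>finite S\<close> by simp
  have contJ: "continuous_on (I \<times> UNIV) (\<lambda>p. J (fst p) (snd p))"
    unfolding J_def V_def
    using \<open>finite S\<close> \<open>S \<noteq> {}\<close>
    by (intro continuous_on_MAX continuous_intros continuous_on_compose2[OF P]
        continuous_on_compose2[OF xh] continuous_on_compose2[OF r]) auto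
  have mid: "J t ((1/2) *\<^sub>R (x + y)) < (J t x + J t y) / 2" if t: "t \<in> I" and "x \<noteq> y" for t x y
  proof -
    have "J t ((1/2) *\<^sub>R (x + y)) \<in> (\<lambda>k. V k t ((1/2) *\<^sub>R (x + y))) ` S"
      unfolding J_def using \<open>finite S\<close> \<open>S \<noteq> {}\<close> by (intro Max_in) auto
    then obtain k where k: "k \<in> S" "J t ((1/2) *\<^sub>R (x + y)) = V k t ((1/2) *\<^sub>R (x + y))"
      by blast
    have pos: "0 < wnorm_sq (P k t) (x - y)"
      using wnorm_sq_pos[OF pd[OF k(1) t], of "x - y"] \<open>x \<noteq> y\<close> by simp
    have "V k t ((1/2) *\<^sub>R (x + y)) = (V k t x + V k t y) / 2 - wnorm_sq (P k t) (x - y) / 4"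
      using wnorm_sq_midpoint[of "P k t" "x - xh k t" "y - xh k t"]
      by (simp add: V_def field_simps)
    also have "\<dots> < (V k t x + V k t y) / 2"
      using pos by linarith
    also have "\<dots> \<le> (J t x + J t y) / 2"
      using V_le_J[OF k(1)] by (intro divide_right_mono add_mono) auto
    finally show ?thesis
      using k(2) by simp
  qed
  obtain k where k: "k \<in> S"
    using \<open>S \<noteq> {}\<close> by blast
  obtain \<alpha> where "\<alpha> > 0" and \<alpha>: "\<And>t x. t \<in> I \<Longrightarrow> \<alpha> * (norm x)\<^sup>2 \<le> wnorm_sq (P k t) x"
    using uniformly_coercive[OF \<open>compact I\<close> P[OF k] pd[OF k]] by blast
  have J0: "continuous_on I (\<lambda>t. J t 0)"
    using continuous_on_compose2[OF contJ, of I "\<lambda>t. (t, 0)"]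
    by (simp add: continuous_on_Pair image_subset_iff)
  have "continuous_on I (\<lambda>t. norm (xh k t))" "continuous_on I (\<lambda>t. \<bar>J t 0 - r k t\<bar>)"
    by (intro continuous_intros xh r k J0)+
  then have "bounded ((\<lambda>t. norm (xh k t)) ` I)" "bounded ((\<lambda>t. \<bar>J t 0 - r k t\<bar>) ` I)"
    by (auto intro!: compact_imp_bounded compact_continuous_image \<open>compact I\<close>)
  then obtain a b where a: "\<And>t. t \<in> I \<Longrightarrow> norm (xh k t) \<le> a"
    and b: "\<And>t. t \<in> I \<Longrightarrow> \<bar>J t 0 - r k t\<bar> \<le> b"
    by (auto simp: bounded_iff)
  \<comment> \<open>Outside this radius the distance \<open>d\<close> from \<open>x\<close> to \<open>xh k t\<close> satisfies \<open>d \<ge> 1\<close> and \<open>\<alpha> * d > b\<close>,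
    so \<open>\<alpha> * d\<^sup>2\<close> exceeds the gap between \<open>J t 0\<close> and \<open>r k t\<close>.\<close>
  have coercive: "J t 0 < J t x" if t: "t \<in> I" and x: "a + (b / \<alpha> + 1) < norm x" for t x
  proof -
    define d where "d = norm (x - xh k t)"
    have "0 \<le> b"
      using b[OF t] by linarith
    have "b / \<alpha> + 1 < d"
      using x a[OF t] norm_triangle_ineq2[of x "xh k t"] by (simp add: d_def)
    moreover from this have "1 \<le> d"
      using \<open>0 \<le> b\<close> \<open>\<alpha> > 0\<close> by (smt (verit) divide_nonneg_pos)
    ultimately have "b < \<alpha> * d" "\<alpha> * d \<le> \<alpha> * d\<^sup>2"
      using \<open>\<alpha> > 0\<close> by (auto simp: field_simps power2_eq_square)
    then have "b < wnorm_sq (P k t) (x - xh k t)"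
      using \<alpha>[OF t, of "x - xh k t"] by (simp add: d_def)
    then have "J t 0 < V k t x"
      using b[OF t] by (simp add: V_def)
    then show ?thesis
      using V_le_J[OF k, of t x] by simp
  qed
  show ?thesis
    using continuous_on_arg_min[OF compact_imp_closed[OF \<open>compact I\<close>] contJ mid coercive]
    by (simp add: J_def V_def)
qed

section \<open>The residual and continuous functions on a bounded interval\<close>

text \<open>Square integrability of \<open>y\<close> makes the integrand integrable, so its indefinite integral is
  continuous.\<close>
lemma output_residual_continuous:
  fixes y :: "real \<Rightarrow> real^'r" and xh :: "real \<Rightarrow> real^'n"
  assumes y: "y \<in> L2_space (lebesgue_on {0<..<T})" and xh: "continuous_on {0..T} xh"
  shows "continuous_on {0..T} (output_residual C Q y xh)"
proof -
  let ?M = "lebesgue_on {0<..<T}"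
  define M where "M = matrix_inv Q"
  define e where "e t = y t - C *v xh t" for t
  obtain K where "K > 0" and K: "\<And>x. \<bar>wnorm_sq M x\<bar> \<le> K * (norm x)\<^sup>2"
    using wnorm_sq_bounded[of M] by blast
  have contC: "continuous_on {0..T} (\<lambda>t. C *v xh t)"
    by (intro continuous_intros xh)
  then have "bounded ((\<lambda>t. C *v xh t) ` {0..T})"
    by (intro compact_imp_bounded compact_continuous_image) auto
  then obtain c where c: "\<And>t. t \<in> {0..T} \<Longrightarrow> norm (C *v xh t) \<le> c"
    by (force simp: bounded_iff)
  have y': "y \<in> borel_measurable ?M" "integrable ?M (\<lambda>t. (norm (y t))\<^sup>2)"
    using y by (simp_all add: L2_space_def)
  have "(\<lambda>t. C *v xh t) \<in> borel_measurable ?M"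
    by (rule continuous_imp_measurable_on_sets_lebesgue[OF continuous_on_subset[OF contC]]) auto
  then have "e \<in> borel_measurable ?M"
    unfolding e_def using y'(1) by (rule borel_measurable_diff[rotated])
  moreover have "wnorm_sq M \<in> borel_measurable borel"
    by (intro borel_measurable_continuous_onI continuous_intros)
  ultimately have meas: "(\<lambda>t. wnorm_sq M (e t)) \<in> borel_measurable ?M"
    by (rule measurable_compose)
  have "integrable ?M (\<lambda>t. wnorm_sq M (e t))"
  proof (rule Bochner_Integration.integrable_bound[OF _ meas])
    show "integrable ?M (\<lambda>t. K * (2 * (norm (y t))\<^sup>2 + 2 * c\<^sup>2))"
      by (intro integrable_mult_right Bochner_Integration.integrable_add y'(2)
          finite_measure.integrable_const finite_measure_lebesgue_on) auto
    have "\<bar>wnorm_sq M (e t)\<bar> \<le> K * (2 * (norm (y t))\<^sup>2 + 2 * c\<^sup>2)" if "t \<in> {0..T}" for t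
    proof -
      have "norm (e t) \<le> norm (y t) + c"
        unfolding e_def using c[OF that] norm_triangle_ineq4[of "y t" "C *v xh t"] by linarith
      then have "(norm (e t))\<^sup>2 \<le> (norm (y t) + c)\<^sup>2"
        by (intro power_mono) auto
      also have "\<dots> \<le> 2 * (norm (y t))\<^sup>2 + 2 * c\<^sup>2"
        using sum_squares_bound[of "norm (y t)" c] by (simp add: power2_sum)
      finally show ?thesis
        using K[of "e t"] \<open>K > 0\<close> by (meson mult_left_mono order_trans less_imp_le)
    qed
    then show "AE t in ?M. norm (wnorm_sq M (e t)) \<le> norm (K * (2 * (norm (y t))\<^sup>2 + 2 * c\<^sup>2))"
      using \<open>K > 0\<close> by (intro AE_I2) (force intro: order_trans[OF _ abs_ge_self])
  qed
  then have "(\<lambda>t. wnorm_sq M (e t)) absolutely_integrable_on {0<..<T}"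
    by (simp add: set_integrable_eq)
  \<comment> \<open>The hypothesis on \<open>y\<close> concerns the open interval only, whereas the residual integrates over
    closed ones; the end points form a null set.\<close>
  then have abs: "(\<lambda>t. wnorm_sq M (e t)) absolutely_integrable_on {0..T}"
    by (simp add: absolutely_integrable_on_Icc_iff_Ioo)
  then have "continuous_on {0..T} (\<lambda>t. integral {0..t} (\<lambda>t. wnorm_sq M (e t)))"
    by (intro indefinite_integral_continuous_1 set_lebesgue_integral_eq_integral(1))
  then show ?thesis
  proof (rule continuous_on_eq)
    fix t assume "t \<in> {0..T}"
    then have "(\<lambda>t. wnorm_sq M (e t)) absolutely_integrable_on {0..t}"
      by (intro set_integrable_subset[OF abs]) auto
    then show "integral {0..t} (\<lambda>t. wnorm_sq M (e t)) = output_residual C Q y xh t"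
      by (simp add: output_residual_def M_def e_def set_lebesgue_integral_eq_integral(2))
  qed
qed

lemma continuous_imp_Linf:
  fixes f :: "real \<Rightarrow> 'b::euclidean_space"
  assumes f: "continuous_on {a..b} f"
  shows "f \<in> borel_measurable (lebesgue_on {a<..<b})"
    and "ess_bounded (lebesgue_on {a<..<b}) f"
    and "f \<in> Linf_space (lebesgue_on {a<..<b})"
proof -
  let ?M = "lebesgue_on {a<..<b}"
  show meas: "f \<in> borel_measurable ?M"
    by (rule continuous_imp_measurable_on_sets_lebesgue[OF continuous_on_subset[OF f]]) auto
  have "bounded (f ` {a..b})"
    using f by (intro compact_imp_bounded compact_continuous_image) auto
  then obtain K where "\<And>t. t \<in> {a..b} \<Longrightarrow> norm (f t) \<le> K"
    by (force simp: bounded_iff)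
  then have K: "AE t in ?M. norm (f t) \<le> K"
    by (intro AE_I2) auto
  then show "ess_bounded ?M f"
    by (auto simp: ess_bounded_def)
  have "esssup ?M (\<lambda>t. ereal (norm (f t))) \<le> ereal K"
    using K meas by (intro esssup_I) auto
  then show "f \<in> Linf_space ?M"
    using meas by (auto simp: Linf_space_def intro: le_less_trans)
qed

section \<open>Measurability and essential boundedness of the worst case minimizer\<close>

theorem corollary4p2:
  fixes T :: real
    and B :: "real^'m^'n" and C :: "real^'n^'r"
    and x0 :: "real^'n" and y :: "real \<Rightarrow> real^'r"
    and SA :: "'a set" and SG :: "'g set" and SR :: "'p set" and SQ :: "'q set"
    and A :: "'a \<Rightarrow> real^'n^'n" and \<Gamma> :: "'g \<Rightarrow> real^'n^'n"
    and R :: "'p \<Rightarrow> real^'m^'m" and Q :: "'q \<Rightarrow> real^'r^'r"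
    and Ric :: "'a \<times> 'g \<times> 'p \<times> 'q \<Rightarrow> real \<Rightarrow> real^'n^'n"
    and xh :: "'a \<times> 'g \<times> 'p \<times> 'q \<Rightarrow> real \<Rightarrow> real^'n"
    and V :: "'a \<times> 'g \<times> 'p \<times> 'q \<Rightarrow> real \<Rightarrow> real^'n \<Rightarrow> real"
    and xinf :: "real \<Rightarrow> real^'n"
  assumes "0 < T"
    and "y \<in> L2_space (lebesgue_on {0<..<T})"
    and "finite SA" "SA \<noteq> {}" and "finite SG" "SG \<noteq> {}"
    and "finite SR" "SR \<noteq> {}" and "finite SQ" "SQ \<noteq> {}"
    and "\<And>g. g \<in> SG \<Longrightarrow> sym_posdef (\<Gamma> g)"
    and "\<And>p. p \<in> SR \<Longrightarrow> sym_posdef (R p)"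
    and "\<And>q. q \<in> SQ \<Longrightarrow> sym_posdef (Q q)"
    and "\<And>a g p q. (a, g, p, q) \<in> SA \<times> SG \<times> SR \<times> SQ \<Longrightarrow>
           riccati_solution T (A a) B C (\<Gamma> g) (R p) (Q q) (Ric (a, g, p, q))"
    and "\<And>a g p q. (a, g, p, q) \<in> SA \<times> SG \<times> SR \<times> SQ \<Longrightarrow>
           observer_solution T (A a) C (Q q) x0 y (Ric (a, g, p, q)) (xh (a, g, p, q))"
    and "\<And>a g p q t x. V (a, g, p, q) t x
           = value_fn C (Q q) y (Ric (a, g, p, q)) (xh (a, g, p, q)) t x"
    and "\<And>t. t \<in> {0..T} \<Longrightarrow>
           xinf t = worst_case_minimizer (SA \<times> SG \<times> SR \<times> SQ) V t"
  shows "xinf \<in> borel_measurable (lebesgue_on {0<..<T}) \<and>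
         ess_bounded (lebesgue_on {0<..<T}) xinf \<and>
         xinf \<in> Linf_space (lebesgue_on {0<..<T})"
proof -
  let ?S = "SA \<times> SG \<times> SR \<times> SQ"
  define P where "P k t = matrix_inv (Ric k t)" for k t
  define r where "r = (\<lambda>(a, g, p, q). output_residual C (Q q) y (xh (a, g, p, q)))"
  have Ric: "continuous_on {0..T} (Ric k) \<and> (\<forall>t\<in>{0..T}. sym_posdef (Ric k t))" if "k \<in> ?S" for k
  proof -
    obtain a g p q where k: "k = (a, g, p, q)" by (cases k)
    then have mem: "(a, g, p, q) \<in> ?S" "g \<in> SG" "p \<in> SR" "q \<in> SQ"
      using that by auto
    define S where "S = transpose C ** matrix_inv (Q q) ** C"
    define W where "W = B ** R p ** transpose B"
    have R: "sym_posdef (R p)" and Q: "sym_posdef (matrix_inv (Q q))"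
      using assms(12,13) mem by (auto intro: sym_posdef_matrix_inv)
    have der: "(Ric k has_vector_derivative A a ** Ric k t + Ric k t ** transpose (A a)
        - Ric k t ** S ** Ric k t + W) (at t within {0..T})" if "t \<in> {0..T}" for t
      using assms(14)[OF mem(1)] that
      by (simp add: riccati_solution_def S_def W_def k matrix_mul_assoc)
    have "transpose S = S" "transpose W = W"
      using Q R by (simp_all add: S_def W_def sym_posdef_def matrix_transpose_mul matrix_mul_assoc)
    moreover have "0 \<le> wnorm_sq W x" for x
    proof -
      have "wnorm_sq W x = wnorm_sq (R p) (transpose B *v x)"
        unfolding wnorm_sq_def W_def
        by (metis inner_matrix_vector_transpose matrix_vector_mul_assoc)
      then show ?thesis
        using wnorm_sq_pos[OF R, of "transpose B *v x"]
        by (cases "transpose B *v x = 0") (auto simp: wnorm_sq_def)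
    qed
    moreover have "sym_posdef (Ric k 0)"
      using assms(11,14) mem by (simp add: riccati_solution_def k)
    ultimately show ?thesis
      using riccati_posdef[OF der] continuous_on_vector_derivative[OF der] by blast
  qed
  have xh: "continuous_on {0..T} (xh k)" if "k \<in> ?S" for k
    using assms(15) that by (cases k) (auto simp: observer_solution_def H1_space_def)
  have "continuous_on {0..T} (r k)" if "k \<in> ?S" for k
    using output_residual_continuous[OF assms(2) xh[OF that]] by (cases k) (simp add: r_def)
  moreover have "continuous_on {0..T} (P k)" if "k \<in> ?S" for k
    unfolding P_def using Ric[OF that] by (intro continuous_on_matrix_inv) (auto intro: sym_posdef_invertible)
  moreover have "sym_posdef (P k t)" if "k \<in> ?S" "t \<in> {0..T}" for k t
    unfolding P_def using Ric[OF that(1)] that(2) by (blast intro: sym_posdef_matrix_inv)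
  ultimately have "continuous_on {0..T} (\<lambda>t. THE x. is_arg_min
      (\<lambda>x. MAX k\<in>?S. wnorm_sq (P k t) (x - xh k t) + r k t) (\<lambda>_. True) x)"
    using assms(3-10) xh by (intro continuous_on_worst_case_minimizer) auto
  moreover have "V k t x = wnorm_sq (P k t) (x - xh k t) + r k t" for k t x
    by (cases k) (simp add: assms(16) value_fn_def P_def r_def)
  ultimately have "continuous_on {0..T} (worst_case_minimizer ?S V)"
    by (simp add: worst_case_minimizer_def[abs_def])
  then have "continuous_on {0..T} xinf"
    by (rule continuous_on_eq) (simp add: assms(17))
  then show ?thesis
    by (simp add: continuous_imp_Linf)
qed

end
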